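(* Let $a, b \in \mathbb{Z}$, $n \in \mathbb{N}$, let $g: \mathbb{N} \to \mathbb{Z}$ be an arithmetic function with $g(1) = 1$, let $m \geq 3$ and let $\zeta_m$ be a primitive $m$-th root of unity. \begin{enumerate} \item If $m$ is divisible by an odd prime and $2 \nmid a$, then $P_n^g(a\zeta_m + b) \neq 0$. \item If $m$ is divisible by a prime $p > 3$ or by $4$, and $3 \nmid a$, and $g(3) \equiv 0$ or $1 \pmod 3$, then $P_n^g(a\zeta_m + b) \neq 0$. \item If $D \equiv 5 \pmod 8$ is square-free and $2 \nmid a$, then $P_n^g(a\omega_D + b) \neq 0$. \item If $D \equiv 2 \pmod 3$ is square-free, $3 \nmid a$, and $g(3) \equiv 0$ or $1 \pmod 3$, then $P_n^g(a\omega_D + b) \neq 0$. \end{enumerate}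
   Context: For an arithmetic function $g:\mathbb{N}\to\mathbb{Z}$ with $g(1)=1$, the polynomials $P_n^g(X) \in \mathbb{Q}[X]$ are defined by the formal power series identity \[\sum_{n=0}^\infty P_n^g(X) q^n = \exp\Big(X \sum_{n=1}^\infty g(n)\frac{q^n}{n}\Big).\] For a square-free integer $D \notin \{0,1\}$, set $\omega_D = \sqrt{D}$ if $D \not\equiv 1 \pmod 4$ and $\omega_D = \frac{1+\sqrt{D}}{2}$ if $D \equiv 1 \pmod 4$. *)

theory Defs
  imports "HOL-Number_Theory.Number_Theory" "HOL-Computational_Algebra.Computational_Algebra"
begin

(* The exponential series as an element of Q[X][[q]]. The constant fps_exp needs a
   coefficient type with inverses, which rat poly is not, so its coefficients are
   embedded as constant polynomials. *)
definition poly_exp_series :: "rat poly fps" where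
  "poly_exp_series = Abs_fps (\<lambda>k. [:fps_exp 1 $ k:])"

definition log_series :: "(nat \<Rightarrow> int) \<Rightarrow> rat poly fps" where
  "log_series g = Abs_fps (\<lambda>n. if n = 0 then 0 else [:of_int (g n) / of_nat n:])"

(* P g n is the coefficient of q^n in exp(X * log_series g). Composition of series is
   meaningful because the inner series has constant term 0; the value g 0 is not used. *)
definition P :: "(nat \<Rightarrow> int) \<Rightarrow> nat \<Rightarrow> rat poly" where
  "P g n = (poly_exp_series oo (fps_const [:0, 1:] * log_series g)) $ n"

definition P_eval :: "(nat \<Rightarrow> int) \<Rightarrow> nat \<Rightarrow> complex \<Rightarrow> complex" where
  "P_eval g n z = poly (map_poly of_rat (P g n)) z"

definition primitive_root_of_unity :: "nat \<Rightarrow> complex \<Rightarrow> bool" where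
  "primitive_root_of_unity m z \<longleftrightarrow> m > 0 \<and> z ^ m = 1 \<and> (\<forall>k. 0 < k \<and> k < m \<longrightarrow> z ^ k \<noteq> 1)"

(* csqrt is the principal branch, so csqrt D = i * sqrt |D| for D < 0. *)
definition omega :: "int \<Rightarrow> complex" where
  "omega D = (if [D = 1] (mod 4) then (1 + csqrt (of_int D)) / 2 else csqrt (of_int D))"

end

theory Submission
  imports Defs
begin

text \<open>
  Write $A_n = n!\, P_n^g(\alpha)$ with $\alpha = a z + b$, where $z$ is $\zeta_m$ or $\omega_D$. The
  differential equation of the exponential series gives a recurrence for $A_n$ with integer
  coefficients, and modulo a prime $p$ it yields $A_{p+r} \equiv A_p A_r$ in $\mathbb{Z}[z]$. For
  $p = 2$, and for $p = 3$ under the condition on $g(3)$, each of $A_0, \ldots, A_p$ is congruent to a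
  product of factors $\alpha + c$ with $c \in \mathbb{Z}$. Hence $A_n \neq 0$ as soon as all $z + c$
  are units modulo $p$, which is checked by exhibiting a multiple that is an integer prime to $p$;
  here zero is not a unit modulo $p$ because $1/p \notin \mathbb{Z}[z]$: the rational elements of the
  finitely generated group $\mathbb{Z}[z]$ have a common denominator, so it cannot contain every
  $1/p^k$.
\<close>

section \<open>The recurrence\<close>

lemma poly_exp_series_deriv: "fps_deriv poly_exp_series = poly_exp_series"
proof (rule fps_ext)
  fix n
  have "fps_deriv (fps_exp (1::rat)) $ n = fps_exp 1 $ n"
    by (simp only: fps_exp_deriv fps_const_1_eq_1 mult_1)
  then have "of_nat (Suc n) * fps_exp (1::rat) $ Suc n = fps_exp 1 $ n"
    by (simp only: fps_deriv_nth Suc_eq_plus1)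
  then have "of_nat (Suc n) * [:fps_exp (1::rat) $ Suc n:] = [:fps_exp 1 $ n:]"
    by (simp only: of_nat_poly mult_pCons_left mult_pCons_right smult_pCons smult_0_right pCons_0_0 add_0_right mult_zero_left mult.commute)
  then show "fps_deriv poly_exp_series $ n = poly_exp_series $ n"
    by (simp only: poly_exp_series_def fps_deriv_nth fps_nth_Abs_fps Suc_eq_plus1)
qed

lemma P_0: "P g 0 = 1"
  by (simp add: P_def poly_exp_series_def fps_compose_nth one_pCons)

text \<open>With F = exp(X L), the chain rule gives F' = X L' F, and the coefficients of q^n are
  compared. Differentiation cancels the denominators of \<open>log_series\<close>, so only the
  integers g(k) remain.\<close>

lemma P_Suc:
  "of_nat (Suc n) * P g (Suc n) = [:0, 1:] * (\<Sum>i\<le>n. P g i * [:of_int (g (Suc (n - i))):])"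
proof -
  let ?L = "fps_const [:0, 1:] * log_series g"
  let ?F = "poly_exp_series oo ?L"
  have "?L $ 0 = 0" by (simp add: log_series_def)
  then have "fps_deriv ?F = ?F * (fps_const [:0, 1:] * fps_deriv (log_series g))"
    by (simp add: fps_compose_deriv poly_exp_series_deriv)
  then have "fps_deriv ?F = fps_const [:0, 1:] * (?F * fps_deriv (log_series g))"
    by (simp only: mult.left_commute)
  then have "fps_deriv ?F $ n = [:0, 1:] * (?F * fps_deriv (log_series g)) $ n"
    by (simp only: fps_mult_left_const_nth)
  moreover have "of_nat (Suc n) * ?F $ Suc n = fps_deriv ?F $ n"
    by (simp only: fps_deriv_nth Suc_eq_plus1)
  moreover have "fps_deriv (log_series g) $ k = [:of_int (g (Suc k)):]" for k
    unfolding fps_deriv_nth log_series_def fps_nth_Abs_fps of_nat_poly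
    by simp
  ultimately show ?thesis
    unfolding P_def by (simp only: fps_mult_nth atLeast0AtMost)
qed

lemma poly_map_poly_of_rat_add:
  "poly (map_poly of_rat (p + q)) (z::complex) = poly (map_poly of_rat p) z + poly (map_poly of_rat q) z"
proof -
  have "map_poly of_rat (p + q) = (map_poly of_rat p + map_poly of_rat q :: complex poly)"
    by (rule poly_eqI) (simp add: coeff_map_poly of_rat_add)
  then show ?thesis by simp
qed

lemma poly_map_poly_of_rat_mult:
  "poly (map_poly of_rat (p * q)) (z::complex) = poly (map_poly of_rat p) z * poly (map_poly of_rat q) z"
proof -
  have "map_poly of_rat (p * q) = (map_poly of_rat p * map_poly of_rat q :: complex poly)"
    by (rule poly_eqI) (simp add: coeff_map_poly coeff_mult of_rat_sum of_rat_mult)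
  then show ?thesis by simp
qed

lemma poly_map_poly_of_rat_sum:
  "poly (map_poly of_rat (\<Sum>i\<in>I. p i)) (z::complex) = (\<Sum>i\<in>I. poly (map_poly of_rat (p i)) z)"
  by (induction I rule: infinite_finite_induct) (simp_all add: poly_map_poly_of_rat_add)

lemma P_eval_0: "P_eval g 0 z = 1"
  by (simp add: P_eval_def P_0)

lemma P_eval_Suc:
  "of_nat (Suc n) * P_eval g (Suc n) z = z * (\<Sum>i\<le>n. P_eval g i z * of_int (g (Suc (n - i))))"
proof -
  have "poly (map_poly of_rat (of_nat (Suc n) * P g (Suc n))) z
      = poly (map_poly of_rat ([:0, 1:] * (\<Sum>i\<le>n. P g i * [:of_int (g (Suc (n - i))):]))) z"
    by (simp only: P_Suc)
  then show ?thesis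
    unfolding poly_map_poly_of_rat_mult poly_map_poly_of_rat_sum of_nat_poly P_eval_def
    by (simp add: map_poly_pCons of_rat_add)
qed

text \<open>The factor n! absorbs the division by n + 1 in the recurrence, whose coefficients thus
  become integers and can be reduced modulo a prime.\<close>

definition scaled_P :: "(nat \<Rightarrow> int) \<Rightarrow> complex \<Rightarrow> nat \<Rightarrow> complex" where
  "scaled_P g z n = fact n * P_eval g n z"

lemma scaled_P_0: "scaled_P g z 0 = 1"
  by (simp add: scaled_P_def P_eval_0)

lemma fact_eq_prod_mult_fact:
  "i \<le> n \<Longrightarrow> (fact n :: nat) = \<Prod>{Suc i..n} * fact i"
  by (induction n rule: dec_induct) (simp_all add: prod.nat_ivl_Suc' algebra_simps)

text \<open>The weight n!/i! is kept as a product over an interval, from which divisibility by p and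
  the effect of a shift by p can be read off.\<close>

lemma scaled_P_Suc:
  "scaled_P g z (Suc n) =
     z * (\<Sum>i\<le>n. of_int (g (Suc (n - i)) * int (\<Prod>{Suc i..n})) * scaled_P g z i)"
proof -
  have "scaled_P g z (Suc n) = fact n * (of_nat (Suc n) * P_eval g (Suc n) z)"
    by (simp add: scaled_P_def)
  also have "\<dots> = z * (\<Sum>i\<le>n. fact n * P_eval g i z * of_int (g (Suc (n - i))))"
    unfolding P_eval_Suc by (simp add: sum_distrib_left mult_ac)
  also have "(\<Sum>i\<le>n. fact n * P_eval g i z * of_int (g (Suc (n - i)))) =
      (\<Sum>i\<le>n. of_int (g (Suc (n - i)) * int (\<Prod>{Suc i..n})) * scaled_P g z i)"
  proof (rule sum.cong)
    fix i assume "i \<in> {..n}"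
    then have "(of_nat (fact n) :: complex) = of_nat (\<Prod>{Suc i..n} * fact i)"
      by (subst fact_eq_prod_mult_fact[of i n]) simp_all
    then have "(fact n :: complex) = of_nat (\<Prod>{Suc i..n}) * fact i"
      by (simp only: of_nat_mult of_nat_fact)
    then show "fact n * P_eval g i z * of_int (g (Suc (n - i))) =
      of_int (g (Suc (n - i)) * int (\<Prod>{Suc i..n})) * scaled_P g z i"
      by (simp add: scaled_P_def)
  qed simp
  finally show ?thesis .
qed

section \<open>Integral extensions\<close>

text \<open>Induction on the number of generators: a rational combination and a fixed one with
  nonzero last coefficient combine to a rational one free of the last generator, to which the
  earlier denominator applies.\<close>

lemma rational_int_combinations_denominator:
  fixes w :: "nat \<Rightarrow> 'a::field_char_0"
  shows "\<exists>M::int. M \<noteq> 0 \<and> (\<forall>c::nat \<Rightarrow> int. (\<Sum>i<d. of_int (c i) * w i) \<in> \<rat> \<longrightarrow>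
           of_int M * (\<Sum>i<d. of_int (c i) * w i) \<in> \<int>)"
proof (induction d)
  case 0
  show ?case by (intro exI[of _ 1]) simp
next
  case (Suc d)
  define s where "s c = (\<Sum>i<d. of_int (c i) * w i)" for c :: "nat \<Rightarrow> int"
  have s_Suc: "(\<Sum>i<Suc d. of_int (c i) * w i) = s c + of_int (c d) * w d" for c :: "nat \<Rightarrow> int"
    by (simp add: s_def)
  from Suc obtain M where M: "M \<noteq> 0" "\<And>c. s c \<in> \<rat> \<Longrightarrow> of_int M * s c \<in> \<int>"
    unfolding s_def by blast
  show ?case
  proof (cases "\<exists>c::nat \<Rightarrow> int. s c + of_int (c d) * w d \<in> \<rat> \<and> c d \<noteq> 0")
    case False
    \<comment> \<open>Every rational combination now has \<open>c d = 0\<close>, so the old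
      denominator still serves.\<close>
    then show ?thesis unfolding s_Suc using M by (intro exI[of _ M]) auto
  next
    case True
    then obtain e where e: "s e + of_int (e d) * w d \<in> \<rat>" "e d \<noteq> 0" by blast
    from e(1) obtain u v :: int where uv: "v \<noteq> 0" "s e + of_int (e d) * w d = of_int u / of_int v"
      by (metis Rats_cases' less_irrefl)
    have "of_int (M * v * e d) * (s c + of_int (c d) * w d) \<in> \<int>"
      if q: "s c + of_int (c d) * w d \<in> \<rat>" for c
    proof -
      \<comment> \<open>These coefficients eliminate \<open>w d\<close>, since the one at index d is
        zero.\<close>
      let ?c = "\<lambda>i. e d * c i - c d * e i"
      have s: "s ?c = of_int (e d) * s c - of_int (c d) * s e"
        by (simp add: s_def sum_distrib_left sum_subtractf algebra_simps)
      then have eq: "s ?c = of_int (e d) * (s c + of_int (c d) * w d)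
          - of_int (c d) * (s e + of_int (e d) * w d)"
        by (simp add: algebra_simps)
      have "s ?c \<in> \<rat>" unfolding eq by (intro Rats_diff Rats_mult Rats_of_int e(1) q)
      then have "of_int M * s ?c \<in> \<int>" by (rule M)
      \<comment> \<open>Multiplication by v clears the denominator of the fixed value u/v; adding
        back \<open>M * c d * u\<close> leaves a multiple of the given combination alone.\<close>
      then have "of_int v * (of_int M * s ?c) + of_int (M * c d * u) \<in> \<int>"
        by (rule Ints_add[OF Ints_mult[OF Ints_of_int] Ints_of_int])
      also have "of_int v * (of_int M * s ?c) + of_int (M * c d * u)
          = of_int (M * v * e d) * (s c + of_int (c d) * w d)"
        unfolding eq uv(2) using uv(1) by (simp add: field_simps)
      finally show ?thesis .
    qed
    then show ?thesis unfolding s_Suc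
      using M(1) uv(1) e(2) by (intro exI[of _ "M * v * e d"]) auto
  qed
qed

text \<open>The ring Z[z]. The polynomials have their coefficients in the field, as in
  \<open>algebraic_int\<close>, which avoids coercing integer polynomials.\<close>

definition int_adjoin :: "'a::field_char_0 \<Rightarrow> 'a set" where
  "int_adjoin z = {poly f z |f. \<forall>i. coeff f i \<in> \<int>}"

text \<open>Horner's scheme: a further multiplication by z shifts the coefficients and produces a
  single term in z^d, which \<open>pow\<close> rewrites.\<close>

lemma int_adjoin_in_span:
  assumes f: "\<forall>i. coeff f i \<in> \<int>" and "0 < d"
    and pow: "z ^ d = (\<Sum>i<d. of_int (e i) * z ^ i)"
  shows "\<exists>c::nat \<Rightarrow> int. poly f z = (\<Sum>i<d. of_int (c i) * z ^ i)"
  using f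
proof (induction f)
  case 0
  show ?case by (intro exI[of _ "\<lambda>_. 0"]) simp
next
  case (pCons a f)
  have "coeff f i \<in> \<int>" for i using pCons.prems[rule_format, of "Suc i"] by simp
  then obtain c :: "nat \<Rightarrow> int" where c: "poly f z = (\<Sum>i<d. of_int (c i) * z ^ i)"
    using pCons.IH by blast
  from pCons.prems[rule_format, of 0] obtain k where k: "a = of_int k" by (auto elim: Ints_cases)
  obtain d' where d': "d = Suc d'" using \<open>0 < d\<close> gr0_implies_Suc by blast
  \<comment> \<open>The shifted coefficients with the new constant term \<open>k\<close>, plus the
    contribution of the old top coefficient \<open>c d'\<close>, which has moved to z^d.\<close>
  let ?c = "\<lambda>i. (if i = 0 then k else c (i - 1)) + c d' * e i"
  have "(\<Sum>i<d. of_int (?c i) * z ^ i) =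
      (\<Sum>i<d. of_int (if i = 0 then k else c (i - 1)) * z ^ i) + of_int (c d') * z ^ d"
    by (simp add: pow sum_distrib_left sum.distrib algebra_simps)
  also have "\<dots> = a + (\<Sum>i<d'. of_int (c i) * z ^ Suc i) + of_int (c d') * z ^ d"
    by (simp add: d' sum.lessThan_Suc_shift k del: sum.lessThan_Suc)
  also have "\<dots> = poly (pCons a f) z"
    by (simp add: c d' sum_distrib_left algebra_simps)
  finally show ?case by metis
qed

lemma inverse_notin_int_adjoin:
  fixes z :: "'a::field_char_0" and p :: nat
  assumes z: "algebraic_int z" and p: "1 < p"
  shows "1 / of_nat p \<notin> int_adjoin z"
proof
  assume "1 / of_nat p \<in> int_adjoin z"
  then obtain f where f: "\<forall>i. coeff f i \<in> \<int>" "1 / of_nat p = poly f z"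
    by (auto simp: int_adjoin_def)
  from z obtain h where h: "lead_coeff h = 1" "\<forall>i. coeff h i \<in> \<int>" "poly h z = 0"
    by (auto elim: algebraic_int.cases)
  define d where "d = degree h"
  \<comment> \<open>A monic constant is 1 and has no root.\<close>
  have "d \<noteq> 0"
  proof
    assume "d = 0"
    then obtain a where "h = [:a:]" using d_def by (metis degree_eq_zeroE)
    then show False using h by simp
  qed
  have "\<exists>k::int. - coeff h i = of_int k" for i
    using h(2) Ints_cases Ints_minus by metis
  then obtain e :: "nat \<Rightarrow> int" where e: "\<And>i. - coeff h i = of_int (e i)" by metis
  have "0 = (\<Sum>i<d. coeff h i * z ^ i) + z ^ d"
    using h(1,3) by (simp add: poly_altdef d_def flip: lessThan_Suc_atMost)
  then have pow: "z ^ d = (\<Sum>i<d. of_int (e i) * z ^ i)"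
    by (simp add: e[symmetric] sum_negf eq_neg_iff_add_eq_0 add.commute)
  obtain M :: int where M: "M \<noteq> 0"
    "\<And>c::nat \<Rightarrow> int. (\<Sum>i<d. of_int (c i) * z ^ i) \<in> \<rat> \<Longrightarrow> of_int M * (\<Sum>i<d. of_int (c i) * z ^ i) \<in> \<int>"
    using rational_int_combinations_denominator[of "\<lambda>i. z ^ i" d] by blast
  \<comment> \<open>The power f^k represents 1/p^k in Z[z], so the common denominator M has to clear
    p^k.\<close>
  have "int (p ^ k) dvd M" for k
  proof -
    have "\<forall>i. coeff (f ^ k) i \<in> \<int>"
      by (induction k) (use f(1) in \<open>auto simp: coeff_mult intro!: Ints_sum Ints_mult\<close>)
    from int_adjoin_in_span[OF this _ pow] \<open>d \<noteq> 0\<close> obtain c :: "nat \<Rightarrow> int"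
      where c: "poly (f ^ k) z = (\<Sum>i<d. of_int (c i) * z ^ i)" by auto
    have q: "poly (f ^ k) z = 1 / of_nat (p ^ k)"
      by (simp add: f(2)[symmetric] power_one_over)
    have "poly (f ^ k) z \<in> \<rat>" unfolding q by (intro Rats_divide Rats_1 Rats_of_nat)
    then have "of_int M * poly (f ^ k) z \<in> \<int>" unfolding c by (rule M)
    then obtain t :: int where "of_int M * (1 / of_nat (p ^ k)) = (of_int t :: 'a)"
      unfolding q by (auto elim: Ints_cases)
    then have "(of_int M :: 'a) = of_int (int (p ^ k) * t)"
      using p by (simp add: field_simps)
    then show ?thesis unfolding of_int_eq_iff by simp
  qed
  \<comment> \<open>The exponent |M| already makes the power of p too large to divide M.\<close>
  then have "int (p ^ nat \<bar>M\<bar>) \<le> \<bar>M\<bar>"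
    using M(1) by (metis dvd_imp_le_int abs_of_nat)
  moreover have "nat \<bar>M\<bar> < p ^ nat \<bar>M\<bar>"
    using p by (intro power_gt_expt) simp
  ultimately show False by linarith
qed

section \<open>Units modulo a prime\<close>

text \<open>The properties of Z[z] on which the congruence argument rests. The last one says that pR
  is a proper ideal, as 1 = p d forces d = 1/p.\<close>

locale subring_mod_prime =
  fixes R :: "'a::field_char_0 set" and p :: nat
  assumes one_closed: "1 \<in> R"
    and diff_closed: "x \<in> R \<Longrightarrow> y \<in> R \<Longrightarrow> x - y \<in> R"
    and mult_closed: "x \<in> R \<Longrightarrow> y \<in> R \<Longrightarrow> x * y \<in> R"
    and prime_p: "prime p"
    and inverse_p_notin: "1 / of_nat p \<notin> R"
begin

lemma zero_closed: "0 \<in> R"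
  using diff_closed[OF one_closed one_closed] by simp

lemma minus_closed: "x \<in> R \<Longrightarrow> - x \<in> R"
  using diff_closed[OF zero_closed] by force

lemma add_closed: "x \<in> R \<Longrightarrow> y \<in> R \<Longrightarrow> x + y \<in> R"
  using diff_closed[OF _ minus_closed] by force

lemma of_nat_closed: "of_nat k \<in> R"
  by (induction k) (simp_all add: zero_closed one_closed add_closed)

lemma of_int_closed: "of_int k \<in> R"
  by (cases k) (simp_all add: of_nat_closed minus_closed del: of_nat_Suc)

lemma power_closed: "x \<in> R \<Longrightarrow> x ^ k \<in> R"
  by (induction k) (simp_all add: one_closed mult_closed)

lemma sum_closed: "(\<And>i. i \<in> I \<Longrightarrow> f i \<in> R) \<Longrightarrow> sum f I \<in> R"
  by (induction I rule: infinite_finite_induct) (simp_all add: zero_closed add_closed)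

lemma numeral_closed: "numeral k \<in> R"
  using of_nat_closed[of "numeral k"] by simp

lemmas closed = numeral_closed one_closed zero_closed minus_closed diff_closed add_closed mult_closed
  of_nat_closed of_int_closed power_closed sum_closed

definition congr :: "'a \<Rightarrow> 'a \<Rightarrow> bool" where
  "congr x y \<longleftrightarrow> (\<exists>d\<in>R. x = y + of_nat p * d)"

lemma congrI: "d \<in> R \<Longrightarrow> x = y + of_nat p * d \<Longrightarrow> congr x y"
  by (auto simp: congr_def)

lemma congr_refl: "congr x x"
  by (rule congrI[OF zero_closed]) simp

lemma congr_trans: "congr x y \<Longrightarrow> congr y z \<Longrightarrow> congr x z"
  unfolding congr_def by (metis add.assoc add_closed distrib_left)

lemma congr_add:
  assumes "congr x y" "congr x' y'"
  shows "congr (x + x') (y + y')"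
proof -
  from assms obtain d d' where "d \<in> R" "d' \<in> R" "x = y + of_nat p * d" "x' = y' + of_nat p * d'"
    by (auto simp: congr_def)
  then show ?thesis by (intro congrI[of "d + d'"]) (auto simp: algebra_simps closed)
qed

text \<open>\<open>congr\<close> also relates elements outside R; y and y' must lie in R for the
  error term y d' + d y' + p d d' to do so.\<close>

lemma congr_mult:
  assumes "congr x y" "congr x' y'" "y \<in> R" "y' \<in> R"
  shows "congr (x * x') (y * y')"
proof -
  from assms obtain d d' where "d \<in> R" "d' \<in> R" "x = y + of_nat p * d" "x' = y' + of_nat p * d'"
    by (auto simp: congr_def)
  then show ?thesis using assms(3,4)
    by (intro congrI[of "y * d' + d * y' + of_nat p * d * d'"]) (auto simp: algebra_simps closed)
qed

lemma congr_sum: "(\<And>i. i \<in> I \<Longrightarrow> congr (f i) (h i)) \<Longrightarrow> congr (sum f I) (sum h I)"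
  by (induction I rule: infinite_finite_induct) (simp_all add: congr_refl congr_add)

lemma congr_of_int:
  assumes "[k = l] (mod int p)"
  shows "congr (of_int k) (of_int l)"
proof -
  from assms obtain t where "k = l + int p * t"
    by (metis cong_iff_lin cong_sym_eq mult.commute)
  then show ?thesis by (intro congrI[of "of_int t"]) (auto simp: of_int_closed)
qed

text \<open>The units of R/pR, described by representatives.\<close>

definition unit_mod :: "'a \<Rightarrow> bool" where
  "unit_mod x \<longleftrightarrow> x \<in> R \<and> (\<exists>y\<in>R. congr (x * y) 1)"

lemma unit_mod_closed: "unit_mod x \<Longrightarrow> x \<in> R"
  by (simp add: unit_mod_def)

lemma unit_mod_1: "unit_mod 1"
  unfolding unit_mod_def using one_closed congr_refl by force

text \<open>An inverse of 0 would put 1/p into R. This is what turns a congruence into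
  nonvanishing.\<close>

lemma unit_mod_nonzero: "\<not> unit_mod 0"
proof
  assume "unit_mod 0"
  then obtain d where d: "d \<in> R" "0 = 1 + of_nat p * d" by (auto simp: unit_mod_def congr_def)
  then have "1 / of_nat p = - d"
    using prime_gt_0_nat[OF prime_p] by (simp add: field_simps eq_neg_iff_add_eq_0)
  then show False using inverse_p_notin minus_closed[OF d(1)] by simp
qed

lemma unit_mod_mult:
  assumes "unit_mod x" "unit_mod y"
  shows "unit_mod (x * y)"
proof -
  from assms obtain x' y' where "x' \<in> R" "y' \<in> R" "congr (x * x') 1" "congr (y * y') 1"
    by (auto simp: unit_mod_def)
  moreover from this have "congr ((x * x') * (y * y')) (1 * 1)"
    by (intro congr_mult one_closed)
  moreover have "(x * x') * (y * y') = (x * y) * (x' * y')" by simp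
  ultimately show ?thesis
    unfolding unit_mod_def
    using assms[THEN unit_mod_closed] by (metis mult_1 mult_closed)
qed

text \<open>If w inverts x y, then y w inverts x. It suffices therefore to exhibit one multiple of x
  that is a unit.\<close>

lemma unit_mod_factor: "x \<in> R \<Longrightarrow> y \<in> R \<Longrightarrow> unit_mod (x * y) \<Longrightarrow> unit_mod x"
  unfolding unit_mod_def by (metis mult.assoc mult_closed)

lemma unit_mod_congr:
  assumes "congr x y" "unit_mod y" "x \<in> R"
  shows "unit_mod x"
proof -
  from assms(2) obtain z where z: "z \<in> R" "congr (y * z) 1" by (auto simp: unit_mod_def)
  have "congr (x * z) (y * z)"
    using assms(1) z(1) by (intro congr_mult congr_refl) (auto intro: unit_mod_closed assms)
  then show ?thesis using z assms(3) congr_trans by (auto simp: unit_mod_def)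
qed

lemma not_dvd_inverse:
  assumes "\<not> int p dvd k"
  obtains l where "[k * l = 1] (mod int p)"
proof -
  have "coprime (int p) k" using assms prime_p by (simp add: prime_imp_coprime)
  then show ?thesis using that cong_solve_coprime_int[of k "int p"] by (auto simp: coprime_commute)
qed

lemma unit_mod_of_int:
  assumes "\<not> int p dvd k"
  shows "unit_mod (of_int k)"
proof -
  from assms obtain l where "[k * l = 1] (mod int p)" by (rule not_dvd_inverse)
  from congr_of_int[OF this] have "congr (of_int k * of_int l) 1" by simp
  then show ?thesis by (auto simp: unit_mod_def of_int_closed)
qed

text \<open>If l inverts a modulo p, then a z + b is congruent to a (z + l b).\<close>

lemma unit_mod_affine:
  assumes "\<not> int p dvd a" and z: "\<And>e. unit_mod (z + of_int e)"
  shows "unit_mod (of_int a * z + of_int b)"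
proof -
  from assms(1) obtain l where l: "[a * l = 1] (mod int p)" by (rule not_dvd_inverse)
  have zR: "z \<in> R" using unit_mod_closed[OF z[of 0]] by simp
  have "[b = a * (l * b)] (mod int p)"
    using cong_scalar_right[OF l, of b] by (simp add: cong_sym_eq mult.assoc)
  from congr_add[OF congr_refl[of "of_int a * z"] congr_of_int[OF this]]
  have "congr (of_int a * z + of_int b) (of_int a * (z + of_int (l * b)))"
    by (simp only: of_int_mult distrib_left)
  then show ?thesis
    by (rule unit_mod_congr) (intro unit_mod_mult unit_mod_of_int assms closed zR)+
qed

text \<open>The reason is that $\theta - 1$ divides $\eta - 1$, and $1 - \eta$ divides $\sum_{i<r} (1 - \eta^i) = r$ for an $r$-th root of unity
  $\eta = \theta^k \neq 1$.\<close>

lemma unit_mod_root_of_unity_diff_1: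
  assumes "\<theta> \<in> R" "\<theta> ^ (k * r) = 1" "\<theta> ^ k \<noteq> 1" "\<not> p dvd r"
  shows "unit_mod (\<theta> - 1)"
proof -
  define \<eta> where "\<eta> = \<theta> ^ k"
  have \<eta>: "\<eta> \<in> R" "\<eta> ^ r = 1" "\<eta> \<noteq> 1"
    using assms by (simp_all add: \<eta>_def power_closed power_mult)
  define u where "u = (\<Sum>i<r. \<Sum>j<i. \<eta> ^ j)"
  have "(\<eta> - 1) * u = (\<Sum>i<r. \<eta> ^ i - 1)"
    by (simp add: u_def sum_distrib_left power_diff_1_eq)
  also have "\<dots> = (\<Sum>i<r. \<eta> ^ i) - of_nat r"
    by (simp add: sum_subtractf)
  also have "(\<Sum>i<r. \<eta> ^ i) = 0"
    using \<eta>(2,3) power_diff_1_eq[of \<eta> r] by simp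
  finally have "(\<theta> - 1) * ((\<Sum>j<k. \<theta> ^ j) * u) = of_int (- int r)"
    by (simp add: \<eta>_def power_diff_1_eq mult.assoc)
  moreover have "unit_mod (of_int (- int r))"
    by (rule unit_mod_of_int) (use assms(4) in simp)
  moreover have "(\<Sum>j<k. \<theta> ^ j) * u \<in> R"
    unfolding u_def using assms(1) \<eta>(1) by (intro closed)
  ultimately show ?thesis
    using unit_mod_factor[of "\<theta> - 1" "(\<Sum>j<k. \<theta> ^ j) * u"] assms(1) by (simp add: closed)
qed

text \<open>The conjugate of z is s - z, and multiplying z + e by its conjugate gives the norm e^2 +
  s e + t.\<close>

lemma unit_mod_quadratic:
  assumes "z \<in> R" "z\<^sup>2 = of_int s * z - of_int t" "\<not> int p dvd e\<^sup>2 + s * e + t"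
  shows "unit_mod (z + of_int e)"
proof (rule unit_mod_factor)
  have "(z + of_int e) * (of_int s - z + of_int e) = of_int (e\<^sup>2 + s * e + t)"
    using assms(2) by (simp add: algebra_simps power2_eq_square)
  then show "unit_mod ((z + of_int e) * (of_int s - z + of_int e))"
    using unit_mod_of_int[OF assms(3)] by simp
qed (use assms(1) in \<open>simp_all add: closed\<close>)

end

section \<open>The recurrence modulo p\<close>

locale scaled_sequence = subring_mod_prime +
  fixes A :: "nat \<Rightarrow> 'a" and g :: "nat \<Rightarrow> int" and \<alpha> :: 'a
  assumes \<alpha>_closed: "\<alpha> \<in> R"
    and A_0: "A 0 = 1"
    and A_Suc: "\<And>n. A (Suc n) = \<alpha> * (\<Sum>i\<le>n. of_int (g (Suc (n - i)) * int (\<Prod>{Suc i..n})) * A i)"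
begin

lemma A_closed: "A n \<in> R"
proof (induction n rule: less_induct)
  case (less n)
  then show ?case
    by (cases n) (auto simp: A_0 A_Suc less_Suc_eq_le simp del: of_int_mult
        intro!: mult_closed sum_closed \<alpha>_closed one_closed of_int_closed)
qed

text \<open>Modulo p, the sequence r -> A (p + r) satisfies the recurrence of A itself, with initial
  value A p instead of 1.\<close>

lemma A_add_p: "congr (A (p + r)) (A p * A r)"
proof (induction r rule: less_induct)
  case (less r)
  show ?case
  proof (cases r)
    case 0
    then show ?thesis by (simp add: A_0 congr_refl)
  next
    case (Suc n)
    let ?c = "\<lambda>n i. g (Suc (n - i)) * int (\<Prod>{Suc i..n})"
    let ?a = "\<lambda>n i. of_int (?c n i) * A i"
    \<comment> \<open>For i < p the interval of the weight contains p itself.\<close>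
    have low: "congr (?a (p + n) i) 0" if "i < p" for i
    proof -
      have "p dvd \<Prod>{Suc i..p + n}" by (rule dvd_prodI) (use that in auto)
      then have "int p dvd ?c (p + n) i" using int_dvd_int_iff by (intro dvd_mult) blast
      then have "[?c (p + n) i = 0] (mod int p)" by (simp add: cong_0_iff)
      from congr_mult[OF congr_of_int[OF this] congr_refl, of "A i"] show ?thesis
        by (simp only: of_int_0 mult_zero_left zero_closed A_closed)
    qed
    \<comment> \<open>For i = p + j the argument of g is unchanged, and each factor t + p of the
      weight is congruent to t.\<close>
    have high: "congr (?a (p + n) (p + j)) (A p * ?a n j)" if "j \<le> n" for j
    proof -
      have "\<Prod>{Suc (p + j)..p + n} = (\<Prod>t\<in>{Suc j..n}. t + p)"
        using prod.shift_bounds_cl_nat_ivl[of "\<lambda>t. t" "Suc j" p n] by (simp add: add.commute)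
      then have "[\<Prod>{Suc (p + j)..p + n} = \<Prod>{Suc j..n}] (mod p)"
        by (simp only:) (intro cong_prod, simp add: cong_def)
      then have "[?c (p + n) (p + j) = ?c n j] (mod int p)"
        by (intro cong_mult) (simp_all only: cong_int_iff cong_refl diff_add_inverse add_diff_cancel_left)
      from congr_mult[OF congr_of_int[OF this] less[of j]] that Suc
      have "congr (?a (p + n) (p + j)) (of_int (?c n j) * (A p * A j))"
        by (simp only: less_Suc_eq_le of_int_closed A_closed mult_closed)
      then show ?thesis by (simp only: mult_ac)
    qed
    have "{..p + n} = {..<p} \<union> {p..p + n}" by auto
    then have "(\<Sum>i\<le>p + n. ?a (p + n) i) = (\<Sum>i<p. ?a (p + n) i) + (\<Sum>i=p..p + n. ?a (p + n) i)"
      by (simp only:) (rule sum.union_disjoint, auto)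
    also have "(\<Sum>i=p..p + n. ?a (p + n) i) = (\<Sum>j\<le>n. ?a (p + n) (p + j))"
      using sum.shift_bounds_cl_nat_ivl[of "?a (p + n)" 0 p n]
      by (simp only: add.commute add_0 atLeast0AtMost)
    finally have eq: "(\<Sum>i\<le>p + n. ?a (p + n) i) =
      (\<Sum>i<p. ?a (p + n) i) + (\<Sum>j\<le>n. ?a (p + n) (p + j))" .
    have "congr (\<Sum>i\<le>p + n. ?a (p + n) i) ((\<Sum>i<p. 0) + (\<Sum>j\<le>n. A p * ?a n j))"
      unfolding eq by (intro congr_add congr_sum low high) auto
    moreover have "(\<Sum>i<p. 0) + (\<Sum>j\<le>n. A p * ?a n j) \<in> R"
      by (intro add_closed sum_closed mult_closed A_closed of_int_closed zero_closed)
    ultimately have "congr (\<alpha> * (\<Sum>i\<le>p + n. ?a (p + n) i)) (\<alpha> * ((\<Sum>i<p. 0) + (\<Sum>j\<le>n. A p * ?a n j)))"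
      by (rule congr_mult[OF congr_refl _ \<alpha>_closed])
    moreover have "\<alpha> * ((\<Sum>i<p. 0) + (\<Sum>j\<le>n. A p * ?a n j)) = A p * A (Suc n)"
      unfolding A_Suc sum_distrib_left[symmetric] by simp
    ultimately show ?thesis unfolding Suc add_Suc_right A_Suc[of "p + n"] by simp
  qed
qed

text \<open>\<open>A_add_p\<close> splits off factors A p until the index is at most p; hence the
  case r = p is among the assumptions.\<close>

lemma unit_mod_A:
  assumes "\<And>r. r \<le> p \<Longrightarrow> unit_mod (A r)"
  shows "unit_mod (A n)"
proof (induction n rule: less_induct)
  case (less n)
  show ?case
  proof (cases "n \<le> p")
    case False
    then have "congr (A n) (A p * A (n - p))" using A_add_p[of "n - p"] by simp
    moreover have "unit_mod (A (n - p))"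
      using False prime_gt_0_nat[OF prime_p] by (intro less) simp
    then have "unit_mod (A p * A (n - p))" by (rule unit_mod_mult[OF assms[OF order_refl]])
    ultimately show ?thesis using A_closed by (rule unit_mod_congr)
  qed (rule assms)
qed

text \<open>Modulo 3, A 3 is \<open>\<alpha> * (\<alpha>^2 - g 3)\<close>. It splits into factors
  \<open>\<alpha> + c\<close> if g(3) is 0 or 1, whereas x^2 - 2 is irreducible modulo 3.\<close>

lemma A_nonzero:
  assumes g1: "g 1 = 1" and unit: "\<And>e. unit_mod (\<alpha> + of_int e)"
    and p: "p = 2 \<or> p = 3 \<and> ([g 3 = 0] (mod 3) \<or> [g 3 = 1] (mod 3))"
  shows "A n \<noteq> 0"
proof -
  have \<alpha>: "unit_mod \<alpha>" using unit[of 0] by simp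
  have A1: "A 1 = \<alpha>" using A_Suc[of 0] g1 by (simp add: A_0)
  have A2: "A 2 = \<alpha> * (\<alpha> + of_int (g 2))"
    using A_Suc[of 1] g1 A1 by (simp add: A_0 numeral_2_eq_2)
  have A3: "A 3 = \<alpha> * (\<alpha>\<^sup>2 + 3 * of_int (g 2) * \<alpha> + 2 * of_int (g 3))"
    using A_Suc[of 2] g1 A1 A2
    by (simp add: A_0 numeral_2_eq_2 numeral_3_eq_3 atMost_Suc algebra_simps)
  have "unit_mod (A r)" if "r \<le> p" for r
  proof -
    have A3_unit: "unit_mod (A 3)" if "p = 3" and g3: "[g 3 = 0] (mod 3) \<or> [g 3 = 1] (mod 3)"
      using g3
    proof
      assume "[g 3 = 0] (mod 3)"
      then obtain k where "g 3 = 3 * k" by (auto simp: cong_0_iff)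
      then have "congr (A 3) (\<alpha> * \<alpha> * \<alpha>)"
        using \<open>p = 3\<close> unfolding A3
        by (intro congrI[of "of_int (g 2) * \<alpha> * \<alpha> + of_int (2 * k) * \<alpha>"])
          (auto intro!: closed \<alpha>_closed simp: algebra_simps power2_eq_square)
      then show ?thesis by (rule unit_mod_congr) (intro unit_mod_mult \<alpha> A_closed)+
    next
      assume "[g 3 = 1] (mod 3)"
      then obtain k where "g 3 = 1 + 3 * k" by (metis cong_iff_lin cong_sym_eq)
      \<comment> \<open>The witness is a third of the difference
        \<open>3 * g 2 * \<alpha>^2 + (6 * k + 3) * \<alpha>\<close>.\<close>
      then have "congr (A 3) (\<alpha> * (\<alpha> + of_int 1) * (\<alpha> + of_int (- 1)))"
        using \<open>p = 3\<close> unfolding A3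
        by (intro congrI[of "of_int (g 2) * \<alpha> * \<alpha> + of_int (2 * k + 1) * \<alpha>"])
          (auto intro!: closed \<alpha>_closed simp: algebra_simps power2_eq_square)
      then show ?thesis by (rule unit_mod_congr) (intro unit_mod_mult \<alpha> A_closed unit)+
    qed
    from that p consider "r = 0" | "r = 1" | "r = 2" | "r = 3" "p = 3" by linarith
    then show ?thesis
    proof cases
      case 1
      then show ?thesis by (simp add: A_0 unit_mod_1)
    next
      case 2
      then show ?thesis by (simp only: A1 \<alpha>)
    next
      case 3
      show ?thesis unfolding 3 A2 by (intro unit_mod_mult \<alpha> unit)
    next
      case 4
      with p have "[g 3 = 0] (mod 3) \<or> [g 3 = 1] (mod 3)" by simp
      with 4 A3_unit show ?thesis by (simp only: simp_thms)
    qed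
  qed
  then show ?thesis using unit_mod_A[of n] unit_mod_nonzero by auto
qed

end

text \<open>Reduces all cases to the units z + e: adding an integer to a z + b only changes b, and
  \<open>scaled_P\<close> differs from \<open>P_eval\<close> by a factorial.\<close>

lemma P_eval_nonzero:
  assumes "subring_mod_prime R p" and "z \<in> R" and "g 1 = 1" and "\<not> int p dvd a"
    and "\<And>e. subring_mod_prime.unit_mod R p (z + of_int e)"
    and "p = 2 \<or> p = 3 \<and> ([g 3 = 0] (mod 3) \<or> [g 3 = 1] (mod 3))"
  shows "P_eval g n (of_int a * z + of_int b) \<noteq> 0"
proof -
  interpret subring_mod_prime R p by fact
  let ?\<alpha> = "of_int a * z + of_int b"
  interpret scaled_sequence R p "scaled_P g ?\<alpha>" g ?\<alpha>
    by unfold_locales (rule scaled_P_0 scaled_P_Suc | intro closed assms(2))+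
  have "unit_mod (?\<alpha> + of_int e)" for e
    using unit_mod_affine[OF assms(4,5), of "b + e"] by (simp add: add.assoc)
  from A_nonzero[OF assms(3) this assms(6), of n] show ?thesis
    by (simp add: scaled_P_def)
qed

lemma subring_mod_prime_int_adjoin:
  assumes "algebraic_int z" "prime p"
  shows "subring_mod_prime (int_adjoin z) p"
proof
  show "1 \<in> int_adjoin z"
    unfolding int_adjoin_def by (auto intro!: exI[of _ 1])
  show "x - y \<in> int_adjoin z" "x * y \<in> int_adjoin z"
    if xy: "x \<in> int_adjoin z" "y \<in> int_adjoin z" for x y
  proof -
    from xy obtain f h where fh: "x = poly f z" "y = poly h z"
      "\<forall>i. coeff f i \<in> \<int>" "\<forall>i. coeff h i \<in> \<int>"
      unfolding int_adjoin_def by blast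
    show "x - y \<in> int_adjoin z"
      unfolding int_adjoin_def using fh by (intro CollectI exI[of _ "f - h"]) auto
    show "x * y \<in> int_adjoin z"
      unfolding int_adjoin_def using fh
      by (intro CollectI exI[of _ "f * h"]) (auto simp: coeff_mult intro!: Ints_sum Ints_mult)
  qed
qed (use assms inverse_notin_int_adjoin prime_gt_1_nat in auto)

lemma in_int_adjoin: "z \<in> int_adjoin z"
proof -
  have "coeff [:0, 1:] i \<in> \<int>" for i
    by (simp add: coeff_pCons split: nat.split)
  then show ?thesis
    unfolding int_adjoin_def by (intro CollectI exI[of _ "[:0, 1:]"]) auto
qed

section \<open>Roots of unity and quadratic integers\<close>

lemma algebraic_int_root_of_unity:
  assumes "z ^ m = 1" "0 < m"
  shows "algebraic_int z"
  by (rule algebraic_int_root[where y = 1 and p = "monom 1 m"])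
    (use assms in \<open>auto simp: poly_monom degree_monom_eq\<close>)

lemma algebraic_int_quadratic:
  fixes z :: "'a::field_char_0"
  assumes "z\<^sup>2 = of_int s * z - of_int t"
  shows "algebraic_int z"
proof (rule algebraic_int.intros)
  show "poly [:of_int t, - of_int s, 1:] z = 0"
    using assms by (simp add: algebra_simps power2_eq_square)
  show "\<forall>i. coeff [:of_int t, - of_int s, 1 :: 'a:] i \<in> \<int>"
    by (auto simp: coeff_pCons split: nat.split)
qed simp

lemma primitive_root_power_neq_1:
  assumes "primitive_root_of_unity m z" "0 < k" "k < m"
  shows "z ^ k \<noteq> 1"
  using assms by (auto simp: primitive_root_of_unity_def)

text \<open>Modulo 2 only z and z - 1 matter. The first is a root of unity; for the second, z^(m/r)
  is a nontrivial r-th root of unity with r odd.\<close>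

lemma P_eval_root_of_unity_mod_2:
  assumes m: "primitive_root_of_unity m z" and g: "g 1 = 1"
    and r: "prime (r::nat)" "odd r" "r dvd m" and a: "\<not> 2 dvd a"
  shows "P_eval g n (of_int a * z + of_int b) \<noteq> 0"
proof -
  have m0: "m > 0" "z ^ m = 1" using m by (auto simp: primitive_root_of_unity_def)
  interpret subring_mod_prime "int_adjoin z" 2
    using m0 by (intro subring_mod_prime_int_adjoin algebraic_int_root_of_unity) auto
  note z = in_int_adjoin[of z]
  from r(3) obtain k where k: "m = k * r" by (metis dvdE mult.commute)
  have u1: "unit_mod (z - 1)"
  proof (rule unit_mod_root_of_unity_diff_1[OF z])
    show "z ^ (k * r) = 1" using m0 k by simp
    show "z ^ k \<noteq> 1"
      by (rule primitive_root_power_neq_1[OF m]) (use m0 k prime_gt_1_nat[OF r(1)] in auto)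
  qed (use r(2) in auto)
  have u0: "unit_mod z"
    by (rule unit_mod_factor[of _ "z ^ (m - 1)"])
      (use m0 in \<open>simp_all add: z power_closed unit_mod_1 flip: power_Suc\<close>)
  have "unit_mod (z + of_int e)" for e
  proof (cases "even e")
    case True
    then have "congr (z + of_int e) (z + of_int 0)"
      by (intro congr_add congr_of_int congr_refl) (simp add: cong_0_iff)
    then show ?thesis using u0 by (rule_tac unit_mod_congr) (auto intro!: closed z)
  next
    case False
    then have "congr (z + of_int e) (z + of_int (- 1))"
      by (intro congr_add congr_of_int congr_refl) (simp add: cong_iff_dvd_diff)
    then show ?thesis using u1 by (rule_tac unit_mod_congr) (auto intro!: closed z)
  qed
  then show ?thesis
    by (intro P_eval_nonzero[where g = g, OF subring_mod_prime_axioms z g]) (use a in auto)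
qed

text \<open>Modulo 3 only z, z - 1 and z + 1 matter. The last two divide z^2 - 1, so the root of
  unity to consider is z^2.\<close>

lemma P_eval_root_of_unity_mod_3:
  assumes m: "primitive_root_of_unity m z" and g: "g 1 = 1"
    and r: "(\<exists>r::nat. prime r \<and> r > 3 \<and> r dvd m) \<or> 4 dvd m" and a: "\<not> 3 dvd a"
    and g3: "[g 3 = 0] (mod 3) \<or> [g 3 = 1] (mod 3)"
  shows "P_eval g n (of_int a * z + of_int b) \<noteq> 0"
proof -
  have m0: "m > 0" "z ^ m = 1" using m by (auto simp: primitive_root_of_unity_def)
  interpret subring_mod_prime "int_adjoin z" 3
    using m0 by (intro subring_mod_prime_int_adjoin algebraic_int_root_of_unity) auto
  note z = in_int_adjoin[of z]
  have "\<exists>k r. (z\<^sup>2) ^ (k * r) = 1 \<and> (z\<^sup>2) ^ k \<noteq> 1 \<and> \<not> 3 dvd r"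
    using r
  proof
    assume "\<exists>r::nat. prime r \<and> r > 3 \<and> r dvd m"
    then obtain r k where r: "prime r" "r > 3" "m = k * r" by (metis dvdE mult.commute)
    have "(z\<^sup>2) ^ (k * r) = (z ^ m)\<^sup>2" by (simp add: r(3) mult.commute flip: power_mult)
    \<comment> \<open>Since r > 3, the exponent 2k is below m = k r.\<close>
    moreover have "z ^ (2 * k) \<noteq> 1"
      by (rule primitive_root_power_neq_1[OF m]) (use m0 r in auto)
    moreover have "\<not> 3 dvd r" using r primes_dvd_imp_eq[of 3 r] by auto
    ultimately show ?thesis using m0 by (intro exI[of _ k] exI[of _ r]) (auto simp: power_mult)
  next
    assume "4 dvd m"
    then obtain k where k: "m = 4 * k" by blast
    \<comment> \<open>Here r = 2 serves, being prime to 3; the exponent 2k is half of m.\<close>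
    have "(z\<^sup>2) ^ (k * 2) = z ^ m" by (simp add: k mult.commute flip: power_mult)
    moreover have "z ^ (2 * k) \<noteq> 1"
      by (rule primitive_root_power_neq_1[OF m]) (use m0 k in auto)
    ultimately show ?thesis using m0 by (intro exI[of _ k] exI[of _ 2]) (auto simp: power_mult)
  qed
  then have "unit_mod (z\<^sup>2 - 1)"
    using unit_mod_root_of_unity_diff_1[OF power_closed[OF z]] by blast
  \<comment> \<open>Both orders are stated because \<open>unit_mod_factor\<close> extracts the left
    factor.\<close>
  then have "unit_mod ((z - 1) * (z + 1))" "unit_mod ((z + 1) * (z - 1))"
    by (simp_all add: algebra_simps power2_eq_square)
  then have u1: "unit_mod (z - 1)" "unit_mod (z + 1)"
    by (auto elim!: unit_mod_factor[rotated 2] intro!: closed z)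
  have u0: "unit_mod z"
    by (rule unit_mod_factor[of _ "z ^ (m - 1)"])
      (use m0 in \<open>simp_all add: z power_closed unit_mod_1 flip: power_Suc\<close>)
  have "unit_mod (z + of_int e)" for e
  proof -
    have "[e = 0] (mod 3) \<or> [e = 1] (mod 3) \<or> [e = - 1] (mod 3)"
      unfolding cong_iff_dvd_diff by presburger
    then obtain c where c: "[e = c] (mod 3)" "unit_mod (z + of_int c)"
      using u0 u1 by (metis add.right_neutral diff_conv_add_uminus of_int_0 of_int_1 of_int_minus)
    then have "congr (z + of_int e) (z + of_int c)"
      by (intro congr_add congr_of_int congr_refl) simp
    then show ?thesis using c(2) by (rule unit_mod_congr) (auto intro!: closed z)
  qed
  then show ?thesis
    by (intro P_eval_nonzero[where g = g, OF subring_mod_prime_axioms z g]) (use a g3 in auto)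
qed

text \<open>The condition \<open>norm\<close> says that x^2 - s x + t, which vanishes at z, has no
  root modulo p.\<close>

lemma P_eval_quadratic:
  fixes p :: nat
  assumes z: "z\<^sup>2 = of_int s * z - of_int t" and norm: "\<And>e. \<not> int p dvd e\<^sup>2 + s * e + t"
    and g: "g 1 = 1" and a: "\<not> int p dvd a"
    and p: "p = 2 \<or> p = 3 \<and> ([g 3 = 0] (mod 3) \<or> [g 3 = 1] (mod 3))"
  shows "P_eval g n (of_int a * z + of_int b) \<noteq> 0"
proof -
  interpret subring_mod_prime "int_adjoin z" p
    using p z by (intro subring_mod_prime_int_adjoin algebraic_int_quadratic) auto
  show ?thesis
    using P_eval_nonzero[where g = g, OF subring_mod_prime_axioms in_int_adjoin g a]
      unit_mod_quadratic[OF in_int_adjoin z norm] p by blast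
qed

text \<open>Trace 1 and norm (1 - D)/4 = -k, written in the shape that
  \<open>P_eval_quadratic\<close> expects.\<close>

lemma omega_square_cong_1_mod_4:
  assumes "D = 1 + 4 * k"
  shows "(omega D)\<^sup>2 = of_int 1 * omega D - of_int (- k)"
proof -
  have "(csqrt (of_int D))\<^sup>2 = 1 + 4 * of_int k" by (simp add: assms)
  moreover have "[D = 1] (mod 4)" by (simp add: assms cong_def)
  ultimately show ?thesis
    by (simp add: omega_def power2_eq_square field_simps)
qed

lemma omega_square_not_cong_1_mod_4:
  assumes "\<not> [D = 1] (mod 4)"
  shows "(omega D)\<^sup>2 = of_int 0 * omega D - of_int (- D)"
  using assms by (simp add: omega_def)

text \<open>2 is not a square modulo 3.\<close>

lemma not_3_dvd_square_minus_2:
  assumes "[D = 2] (mod 3)"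
  shows "\<not> 3 dvd x\<^sup>2 - (D :: int)"
proof
  assume "3 dvd x\<^sup>2 - D"
  then have "[x\<^sup>2 = D] (mod 3)" by (simp add: cong_iff_dvd_diff)
  then have "[x\<^sup>2 = 2] (mod 3)" using assms by (rule cong_trans)
  moreover have "x mod 3 = 0 \<or> x mod 3 = 1 \<or> x mod 3 = 2" by presburger
  then have "x\<^sup>2 mod 3 \<noteq> 2"
    by (subst power_mod[symmetric]) auto
  ultimately show False by (simp add: cong_def)
qed

theorem theorem5:
  fixes a b :: int and n m :: nat and g :: "nat \<Rightarrow> int" and \<zeta> :: complex
  assumes "g 1 = 1"
    and "m \<ge> 3"
    and "primitive_root_of_unity m \<zeta>"
  shows "((\<exists>p::nat. prime p \<and> odd p \<and> p dvd m) \<and> \<not> 2 dvd a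
            \<longrightarrow> P_eval g n (of_int a * \<zeta> + of_int b) \<noteq> 0) \<and>
         (((\<exists>p::nat. prime p \<and> p > 3 \<and> p dvd m) \<or> 4 dvd m) \<and> \<not> 3 dvd a
              \<and> ([g 3 = 0] (mod 3) \<or> [g 3 = 1] (mod 3))
            \<longrightarrow> P_eval g n (of_int a * \<zeta> + of_int b) \<noteq> 0) \<and>
         (\<forall>D::int. squarefree D \<and> [D = 5] (mod 8) \<and> \<not> 2 dvd a
            \<longrightarrow> P_eval g n (of_int a * omega D + of_int b) \<noteq> 0) \<and>
         (\<forall>D::int. squarefree D \<and> [D = 2] (mod 3) \<and> \<not> 3 dvd a
              \<and> ([g 3 = 0] (mod 3) \<or> [g 3 = 1] (mod 3))
            \<longrightarrow> P_eval g n (of_int a * omega D + of_int b) \<noteq> 0)"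
proof (intro conjI impI allI)
  assume "(\<exists>p::nat. prime p \<and> odd p \<and> p dvd m) \<and> \<not> 2 dvd a"
  then show "P_eval g n (of_int a * \<zeta> + of_int b) \<noteq> 0"
    using P_eval_root_of_unity_mod_2[where g = g, OF assms(3,1)] by blast
next
  assume "((\<exists>p::nat. prime p \<and> p > 3 \<and> p dvd m) \<or> 4 dvd m) \<and> \<not> 3 dvd a
              \<and> ([g 3 = 0] (mod 3) \<or> [g 3 = 1] (mod 3))"
  then show "P_eval g n (of_int a * \<zeta> + of_int b) \<noteq> 0"
    using P_eval_root_of_unity_mod_3[where g = g, OF assms(3,1)] by blast
next
  fix D :: int
  assume D: "squarefree D \<and> [D = 5] (mod 8) \<and> \<not> 2 dvd a"
  then obtain k where "D = 5 + 8 * k" by (metis cong_iff_lin cong_sym_eq)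
  then have "D = 1 + 4 * (2 * k + 1)" by simp
  from omega_square_cong_1_mod_4[OF this]
  \<comment> \<open>The norm e^2 + e - (2k + 1) is odd because e^2 + e is even.\<close>
  show "P_eval g n (of_int a * omega D + of_int b) \<noteq> 0"
    by (rule P_eval_quadratic[where p = 2]) (use D assms(1) in auto)
next
  fix D :: int
  assume D: "squarefree D \<and> [D = 2] (mod 3) \<and> \<not> 3 dvd a
              \<and> ([g 3 = 0] (mod 3) \<or> [g 3 = 1] (mod 3))"
  show "P_eval g n (of_int a * omega D + of_int b) \<noteq> 0"
  proof (cases "[D = 1] (mod 4)")
    case True
    then obtain k where k: "D = 1 + 4 * k" by (metis cong_iff_lin cong_sym_eq)
    have "\<not> 3 dvd e\<^sup>2 + 1 * e + - k" for e
    proof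
      assume "3 dvd e\<^sup>2 + 1 * e + - k"
      \<comment> \<open>The factor 4 completes the square, turning the norm into (2e + 1)^2 -
        D.\<close>
      then have "3 dvd 4 * (e\<^sup>2 + 1 * e + - k)" by (rule dvd_mult)
      moreover have "4 * (e\<^sup>2 + 1 * e + - k) = (2 * e + 1)\<^sup>2 - D"
        by (simp add: k power2_eq_square algebra_simps)
      ultimately show False using not_3_dvd_square_minus_2[of D "2 * e + 1"] D by simp
    qed
    then show ?thesis
      using P_eval_quadratic[where p = 3, OF omega_square_cong_1_mod_4[OF k]] D assms(1) by auto
  next
    case False
    \<comment> \<open>Here the norm is e^2 - D itself.\<close>
    from omega_square_not_cong_1_mod_4[OF this] show ?thesis
      by (rule P_eval_quadratic[where p = 3]) (use D assms(1) not_3_dvd_square_minus_2 in auto)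
  qed
qed

end
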